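(* For each $r\in\mathbb{N}=\{0,1,2,\ldots\}$ there exists $\gamma_r\in(0,\infty)$ such that $$\mathcal{R}^r_{MS}\subset\mathcal{R}^r_{ref}\cap\mathcal{R}^r_{AS}\subset\mathcal{R}^r_{ref}\cup\mathcal{R}^r_{AS}\subset\{z\in\mathbb{C}\colon|z|<\gamma_r\}.$$ Moreover, $$\mathbb{C}_-\subset\bigcup_{r=0}^\infty\mathcal{R}^r_{MS}.$$
   Context: $\mathbb{C}_-=\{z\in\mathbb{C}\colon\Re(z)<0\}$. For $r\in\mathbb{N}$ (with $0\in\mathbb{N}$) and $z\in\mathbb{C}$ define $f_{r,z}\colon\mathbb{R}\to\mathbb{C}$ by $f_{r,z}(t)=\sum_{j=0}^{r+1}\frac{z^j}{j!}+\frac{t^{r+1}}{(r+1)!}z^{r+2}$. Let $\tau_1,\tau_2,\ldots$ be independent random variables, uniformly distributed on $[0,1]$, on a probability space $(\Omega,\Sigma,\mathbb{P})$, and fix $\eta\neq 0$. For $z\in\mathbb{C}$ put $v^r_k=v^r_k(z)=\eta\prod_{l=1}^k f_{r,z}(\tau_l)$, $k\in\mathbb{N}$. (This is the output of the randomized Taylor scheme with step-size $h>0$ applied to the test problem $y'=\lambda y$, $y(0)=\eta$, where $z=\lambda h$.) Define $\mathcal{R}^r_{MS}=\{z\in\mathbb{C}\colon v^r_k\to0 \text{ in } L^2(\Omega) \text{ as } k\to\infty\}$ (region of mean-square stability), $\mathcal{R}^r_{AS}=\{z\in\mathbb{C}\colon v^r_k\to0 \text{ almost surely as } k\to\infty\}$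 (region of asymptotic stability), $\mathcal{R}^r_{ref}=\{z\in\mathbb{C}\colon |\sum_{j=0}^{r+2}\frac{z^j}{j!}|<1\}$ (reference set). *)

theory Defs
  imports "HOL-Probability.Probability"
begin

definition taylor_factor :: "nat \<Rightarrow> complex \<Rightarrow> real \<Rightarrow> complex" where
  "taylor_factor r z t =
     (\<Sum>j=0..r+1. z ^ j / fact j) + complex_of_real (t ^ (r+1) / fact (r+1)) * z ^ (r+2)"

text \<open>The random variables are indexed from 1; the value of \<open>\<tau>\<close> at 0 is never used.\<close>

definition taylor_scheme ::
  "nat \<Rightarrow> complex \<Rightarrow> (nat \<Rightarrow> 'a \<Rightarrow> real) \<Rightarrow> complex \<Rightarrow> nat \<Rightarrow> 'a \<Rightarrow> complex" where
  "taylor_scheme r \<eta> \<tau> z k \<omega> = \<eta> * (\<Prod>l=1..k. taylor_factor r z (\<tau> l \<omega>))"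

text \<open>Measurability and square-integrability are explicit, because the Bochner integral
  of a non-integrable function is 0.\<close>

definition tendsto_zero_L2 :: "'a measure \<Rightarrow> (nat \<Rightarrow> 'a \<Rightarrow> complex) \<Rightarrow> bool" where
  "tendsto_zero_L2 M X \<longleftrightarrow>
     (\<forall>k. X k \<in> borel_measurable M \<and> integrable M (\<lambda>\<omega>. (cmod (X k \<omega>))\<^sup>2)) \<and>
     (\<lambda>k. \<integral>\<omega>. (cmod (X k \<omega>))\<^sup>2 \<partial>M) \<longlonglongrightarrow> 0"

definition region_MS ::
  "'a measure \<Rightarrow> (nat \<Rightarrow> 'a \<Rightarrow> real) \<Rightarrow> complex \<Rightarrow> nat \<Rightarrow> complex set" where
  "region_MS M \<tau> \<eta> r = {z. tendsto_zero_L2 M (taylor_scheme r \<eta> \<tau> z)}"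

definition region_AS ::
  "'a measure \<Rightarrow> (nat \<Rightarrow> 'a \<Rightarrow> real) \<Rightarrow> complex \<Rightarrow> nat \<Rightarrow> complex set" where
  "region_AS M \<tau> \<eta> r = {z. AE \<omega> in M. (\<lambda>k. taylor_scheme r \<eta> \<tau> z k \<omega>) \<longlonglongrightarrow> 0}"

definition region_ref :: "nat \<Rightarrow> complex set" where
  "region_ref r = {z. cmod (\<Sum>j=0..r+2. z ^ j / fact j) < 1}"

end

theory Submission
  imports Defs
begin

text \<open>By independence the second moment of the scheme is \<open>|\<eta>|\<^sup>2 q\<^sup>k\<close> with \<open>q\<close> the second moment
  of one factor \<open>f\<close>, so mean-square stability means \<open>q < 1\<close>. The mean of \<open>f\<close> is the Taylor polynomial
  of degree \<open>r+2\<close>, and \<open>q\<close> bounds its squared modulus; moreover the second moments are summable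
  if \<open>q < 1\<close>, which gives almost sure convergence.

  The asymptotic region is bounded by a negative moment argument: on \<open>[0,1]\<close> the factor satisfies
  \<open>|f(t)| \<ge> w(t)\<^bsup>2(r+1)\<^esup>\<close> with \<open>w(t) = c |t - b|\<^bsup>1/2\<^esup>\<close>, where \<open>c\<close> grows with \<open>|z|\<close>. For large \<open>|z|\<close>
  the mean of \<open>1/w\<close> is less than 1, so the products of \<open>1/w(\<tau>\<^sub>l)\<close> tend to 0 almost surely, and those
  of \<open>f(\<tau>\<^sub>l)\<close> cannot. Finally, \<open>f\<close> converges to \<open>exp z\<close> uniformly on \<open>[0,1]\<close> as \<open>r\<close> tends
  to infinity, and \<open>|exp z| < 1\<close> in the left half-plane.\<close>

section \<open>Products of functions of an i.i.d. sequence\<close>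

locale iid_sequence = prob_space M for M :: "'a measure" +
  fixes X :: "nat \<Rightarrow> 'a \<Rightarrow> real" and D :: "real measure"
  assumes indep: "indep_vars (\<lambda>_. borel) X {1..}"
    and law: "l \<ge> 1 \<Longrightarrow> distr M borel (X l) = D"
begin

lemma rv: "l \<ge> 1 \<Longrightarrow> X l \<in> borel_measurable M"
  using indep by (auto simp: indep_vars_def)

text \<open>The premise matches what the measurability rule for finite products supplies, so
  \<open>measurable\<close> can apply it to products over \<open>{1..k}\<close>.\<close>

lemma rv_atLeastAtMost [measurable]: "l \<in> {1..k} \<Longrightarrow> X l \<in> borel_measurable M"
  by (rule rv) simp

lemma nn_integral_law:
  assumes "\<phi> \<in> borel_measurable borel" and "l \<ge> 1"
  shows "(\<integral>\<^sup>+\<omega>. \<phi> (X l \<omega>) \<partial>M) = (\<integral>\<^sup>+t. \<phi> t \<partial>D)"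
  unfolding law[OF assms(2), symmetric] using rv[of l] assms by (intro nn_integral_distr[symmetric]) auto

text \<open>Independence passes to the variables \<open>\<phi> (X l \<omega>)\<close>, and all of
  them have the same mean. Values in \<open>ennreal\<close> avoid any integrability
  condition.\<close>

lemma nn_integral_prod:
  assumes [measurable]: "\<phi> \<in> borel_measurable borel"
  shows "(\<integral>\<^sup>+\<omega>. (\<Prod>l=1..k. \<phi> (X l \<omega>)) \<partial>M) = (\<integral>\<^sup>+t. \<phi> t \<partial>D) ^ k"
proof -
  have "indep_vars (\<lambda>_. borel) (\<lambda>l \<omega>. \<phi> (X l \<omega>)) {1..k}"
    by (rule indep_vars_compose2[OF indep_vars_subset[OF indep]]) auto
  then have "(\<integral>\<^sup>+\<omega>. (\<Prod>l=1..k. \<phi> (X l \<omega>)) \<partial>M) = (\<Prod>l=1..k. \<integral>\<^sup>+\<omega>. \<phi> (X l \<omega>) \<partial>M)"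
    by (intro indep_vars_nn_integral) auto
  also have "\<dots> = (\<Prod>l=1..k. \<integral>\<^sup>+t. \<phi> t \<partial>D)"
    by (intro prod.cong) (auto simp: nn_integral_law)
  finally show ?thesis by simp
qed

text \<open>The means of the products form a geometric sequence of ratio less than 1. So the series
  of the products has finite mean, hence converges almost surely, and its terms vanish.\<close>

lemma AE_prod_tendsto_0:
  fixes g :: "real \<Rightarrow> real"
  assumes [measurable]: "g \<in> borel_measurable borel" and nonneg: "\<And>t. g t \<ge> 0"
    and less: "(\<integral>\<^sup>+t. ennreal (g t) \<partial>D) < 1"
  shows "AE \<omega> in M. (\<lambda>k. \<Prod>l=1..k. g (X l \<omega>)) \<longlonglongrightarrow> 0"
proof -
  obtain q where q: "(\<integral>\<^sup>+t. ennreal (g t) \<partial>D) = ennreal q" "0 \<le> q" "q < 1"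
    using less by (cases "\<integral>\<^sup>+t. ennreal (g t) \<partial>D") auto
  have [measurable]: "(\<lambda>\<omega>. \<Prod>l=1..k. g (X l \<omega>)) \<in> borel_measurable M" for k
    by measurable
  have "(\<integral>\<^sup>+\<omega>. (\<Sum>k. ennreal (\<Prod>l=1..k. g (X l \<omega>))) \<partial>M) =
        (\<Sum>k. \<integral>\<^sup>+\<omega>. ennreal (\<Prod>l=1..k. g (X l \<omega>)) \<partial>M)"
    by (rule nn_integral_suminf) measurable
  also have "\<dots> = (\<Sum>k. ennreal (q ^ k))"
    using nn_integral_prod[of "\<lambda>t. ennreal (g t)"] q nonneg
    by (simp add: prod_ennreal ennreal_power)
  also have "\<dots> = ennreal (\<Sum>k. q ^ k)"
    using q by (intro suminf_ennreal2) auto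
  finally have "(\<integral>\<^sup>+\<omega>. (\<Sum>k. ennreal (\<Prod>l=1..k. g (X l \<omega>))) \<partial>M) \<noteq> \<infinity>"
    by simp
  then have "AE \<omega> in M. (\<Sum>k. ennreal (\<Prod>l=1..k. g (X l \<omega>))) \<noteq> \<infinity>"
    by (rule nn_integral_PInf_AE[rotated]) measurable
  then show ?thesis
  proof eventually_elim
    case (elim \<omega>)
    have "summable (\<lambda>k. \<Prod>l=1..k. g (X l \<omega>))"
      using elim nonneg by (intro summable_suminf_not_top) (auto intro: prod_nonneg)
    then show ?case by (rule summable_LIMSEQ_zero)
  qed
qed

end

section \<open>The uniform law and the moments of the Taylor factor\<close>

abbreviation unit_uniform :: "real measure" where
  "unit_uniform \<equiv> uniform_measure lborel {0..1}"

interpretation unit_uniform: prob_space unit_uniform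
  by (rule prob_space_uniform_measure) auto

lemma AE_unit_uniform: "AE t in unit_uniform. t \<in> {0..1}"
  by (rule AE_uniform_measureI) auto

lemma unit_uniform_density: "unit_uniform = density lborel (\<lambda>t. ennreal (indicator {0..1} t))"
  by (simp add: uniform_measure_def divide_ennreal_def ennreal_indicator)

lemma integral_power_unit_uniform: "(\<integral>t. t ^ n \<partial>unit_uniform) = 1 / (real n + 1)"
  using integral_power[of 0 1 n]
  by (simp add: unit_uniform_density integral_density mult.commute)

lemma taylor_factor_measurable [measurable]: "taylor_factor r z \<in> borel_measurable borel"
  unfolding taylor_factor_def by (intro borel_measurable_continuous_onI continuous_intros) simp

text \<open>The bound is uniform in \<open>t\<close>: it yields integrability for fixed
  \<open>r\<close>, and it controls the second moment as \<open>r\<close> grows.\<close>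

lemma norm_taylor_factor_le:
  assumes "t \<in> {0..1}"
  shows "cmod (taylor_factor r z t) \<le>
    cmod (\<Sum>j=0..r+1. z ^ j / fact j) + cmod z ^ (r+2) / fact (r+1)"
proof -
  have "t ^ (r+1) \<le> 1" "0 \<le> t ^ (r+1)"
    using assms by (auto intro!: power_le_one mult_le_one)
  then have "cmod (complex_of_real (t ^ (r+1) / fact (r+1)) * z ^ (r+2)) \<le> cmod z ^ (r+2) / fact (r+1)"
    unfolding norm_mult norm_power norm_of_real
    by (simp add: field_simps mult_left_le_one_le del: power_Suc fact_Suc)
  then show ?thesis
    unfolding taylor_factor_def using norm_triangle_ineq order_trans add_left_mono by blast
qed

lemma integrable_taylor_factor:
  "integrable unit_uniform (taylor_factor r z)"
  "integrable unit_uniform (\<lambda>t. cmod (taylor_factor r z t))"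
  "integrable unit_uniform (\<lambda>t. (cmod (taylor_factor r z t))\<^sup>2)"
proof -
  let ?B = "cmod (\<Sum>j=0..r+1. z ^ j / fact j) + cmod z ^ (r+2) / fact (r+1)"
  have ae: "AE t in unit_uniform. cmod (taylor_factor r z t) \<le> ?B"
    using AE_unit_uniform by eventually_elim (rule norm_taylor_factor_le)
  show "integrable unit_uniform (taylor_factor r z)"
    using ae by (rule unit_uniform.integrable_const_bound) measurable
  then show "integrable unit_uniform (\<lambda>t. cmod (taylor_factor r z t))"
    by (rule integrable_norm)
  show "integrable unit_uniform (\<lambda>t. (cmod (taylor_factor r z t))\<^sup>2)"
  proof (rule unit_uniform.integrable_const_bound)
    show "AE t in unit_uniform. norm ((cmod (taylor_factor r z t))\<^sup>2) \<le> ?B\<^sup>2"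
      using ae by eventually_elim (simp add: power_mono)
  qed measurable
qed

lemma integral_taylor_factor:
  "(\<integral>t. taylor_factor r z t \<partial>unit_uniform) = (\<Sum>j=0..r+2. z ^ j / fact j)"
proof -
  have int: "integrable unit_uniform (\<lambda>t. t ^ (r+1))"
  proof (rule unit_uniform.integrable_const_bound[where B=1])
    show "AE t in unit_uniform. norm (t ^ (r+1)) \<le> 1"
      using AE_unit_uniform by eventually_elim (auto simp: abs_mult power_abs intro!: mult_le_one power_le_one)
  qed measurable
  have "(\<integral>t. taylor_factor r z t \<partial>unit_uniform) =
     (\<integral>t. (\<Sum>j=0..r+1. z ^ j / fact j) + complex_of_real (t ^ (r+1)) * (z ^ (r+2) / fact (r+1)) \<partial>unit_uniform)"
    unfolding taylor_factor_def by (intro Bochner_Integration.integral_cong) (auto simp: field_simps)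
  also have "\<dots> = (\<Sum>j=0..r+1. z ^ j / fact j) +
      complex_of_real (\<integral>t. t ^ (r+1) \<partial>unit_uniform) * (z ^ (r+2) / fact (r+1))"
    using integrable_of_real[OF int, where ?'a=complex]
    by (subst Bochner_Integration.integral_add)
      (simp_all only: integrable_mult_left integral_mult_left_zero integral_complex_of_real
        unit_uniform.integrable_const lebesgue_integral_const unit_uniform.prob_space scaleR_one)
  \<comment> \<open>The mean of \<open>t ^ (r+1)\<close> is 1/(r+2), which turns 1/(r+1)! into
    1/(r+2)! and so produces the missing Taylor term.\<close>
  also have "complex_of_real (\<integral>t. t ^ (r+1) \<partial>unit_uniform) * (z ^ (r+2) / fact (r+1)) =
      z ^ (r+2) / fact (r+2)"
    unfolding integral_power_unit_uniform by (simp add: field_simps)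
  finally show ?thesis by simp
qed

text \<open>The ratio \<open>q\<close> of the overview. Integrating against the uniform law makes it
  independent of the sample space.\<close>

definition second_moment :: "nat \<Rightarrow> complex \<Rightarrow> real" where
  "second_moment r z = (\<integral>t. (cmod (taylor_factor r z t))\<^sup>2 \<partial>unit_uniform)"

lemma second_moment_nonneg: "0 \<le> second_moment r z"
  by (simp add: second_moment_def)

lemma nn_integral_second_moment:
  "(\<integral>\<^sup>+t. ennreal ((cmod (taylor_factor r z t))\<^sup>2) \<partial>unit_uniform) = ennreal (second_moment r z)"
  unfolding second_moment_def by (intro nn_integral_eq_integral integrable_taylor_factor) auto

text \<open>The left side is the squared modulus of the mean of the factor. It is at most the square
  of the mean modulus, and the variance of the modulus is nonnegative.\<close>

lemma norm_taylor_poly_le_second_moment: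
  "(cmod (\<Sum>j=0..r+2. z ^ j / fact j))\<^sup>2 \<le> second_moment r z"
proof -
  let ?f = "\<lambda>t. cmod (taylor_factor r z t)"
  have "cmod (\<Sum>j=0..r+2. z ^ j / fact j) \<le> (\<integral>t. ?f t \<partial>unit_uniform)"
    unfolding integral_taylor_factor[symmetric] by (rule integral_norm_bound)
  then have "(cmod (\<Sum>j=0..r+2. z ^ j / fact j))\<^sup>2 \<le> (\<integral>t. ?f t \<partial>unit_uniform)\<^sup>2"
    by (simp add: power_mono)
  also have "\<dots> \<le> second_moment r z"
    using unit_uniform.variance_eq[OF integrable_taylor_factor(2,3)[of r z]]
      unit_uniform.variance_positive[of ?f]
    by (simp add: second_moment_def)
  finally show ?thesis .
qed

lemma second_moment_less_1_if_Re_neg: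
  assumes "Re z < 0"
  shows "\<exists>r. second_moment r z < 1"
proof -
  have "(\<lambda>n. z ^ n / fact n) sums exp z"
    using exp_converges[of z] by (simp add: scaleR_conv_of_real divide_inverse mult.commute)
  then have "(\<lambda>n. \<Sum>j\<le>n. z ^ j / fact j) \<longlonglongrightarrow> exp z"
    by (simp add: sums_def_le)
  then have "(\<lambda>r. cmod (\<Sum>j\<le>Suc r. z ^ j / fact j)) \<longlonglongrightarrow> cmod (exp z)"
    by (intro tendsto_norm LIMSEQ_Suc)
  then have lim1: "(\<lambda>r. cmod (\<Sum>j=0..r+1. z ^ j / fact j)) \<longlonglongrightarrow> cmod (exp z)"
    by (simp add: atLeast0AtMost)
  have "(\<lambda>n. cmod z ^ n / fact n) \<longlonglongrightarrow> 0"
    using summable_LIMSEQ_zero[OF summable_exp[of "cmod z"]] by (simp add: divide_inverse mult.commute)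
  \<comment> \<open>With one factor \<open>cmod z\<close> split off, the rest is a term of the
    exponential series at \<open>cmod z\<close>.\<close>
  then have "(\<lambda>r. cmod z * (cmod z ^ Suc r / fact (Suc r))) \<longlonglongrightarrow> cmod z * 0"
    by (intro tendsto_mult_left LIMSEQ_Suc)
  then have lim2: "(\<lambda>r. cmod z ^ (r+2) / fact (r+1)) \<longlonglongrightarrow> 0"
    by (simp del: fact_Suc)
  have "(\<lambda>r. cmod (\<Sum>j=0..r+1. z ^ j / fact j) + cmod z ^ (r+2) / fact (r+1)) \<longlonglongrightarrow> cmod (exp z)"
    using tendsto_add[OF lim1 lim2] by simp
  then have "\<forall>\<^sub>F r in sequentially.
      cmod (\<Sum>j=0..r+1. z ^ j / fact j) + cmod z ^ (r+2) / fact (r+1) < 1"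
    \<comment> \<open>The modulus of \<open>exp z\<close> is \<open>exp (Re z)\<close>, which is
      less than 1.\<close>
    by (rule order_tendstoD) (use assms in simp)
  then obtain r where r: "cmod (\<Sum>j=0..r+1. z ^ j / fact j) + cmod z ^ (r+2) / fact (r+1) < 1" (is "?B < 1")
    using eventually_happens'[OF sequentially_bot] by blast
  have "second_moment r z \<le> (\<integral>t. ?B\<^sup>2 \<partial>unit_uniform)"
    unfolding second_moment_def
  proof (rule integral_mono_AE)
    show "AE t in unit_uniform. (cmod (taylor_factor r z t))\<^sup>2 \<le> ?B\<^sup>2"
      using AE_unit_uniform by eventually_elim (intro power_mono norm_taylor_factor_le, auto)
  qed (auto intro: integrable_taylor_factor)
  also have "\<dots> < 1"
    using r by (simp add: unit_uniform.prob_space power_less_one_iff abs_square_less_1)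
  finally show ?thesis by blast
qed

section \<open>Lower bounds for the factor and a negative moment\<close>

lemma abs_power_diff_ge:
  fixes s t :: real
  assumes "0 \<le> s" "0 \<le> t" "n \<noteq> 0"
  shows "\<bar>s - t\<bar> ^ n \<le> \<bar>s ^ n - t ^ n\<bar>"
proof -
  \<comment> \<open>Superadditivity of the power on nonnegative reals; applied to the smaller of
    \<open>s\<close>, \<open>t\<close> and their distance, it gives the claim.\<close>
  have super: "a ^ n + b ^ n \<le> (a + b) ^ n" if "0 \<le> a" "0 \<le> b" for a b :: real
    using \<open>n \<noteq> 0\<close>[unfolded neq0_conv]
  proof (induction n rule: nat_induct_non_zero)
    case (Suc n)
    have "a ^ Suc n + b ^ Suc n \<le> (a + b) * (a ^ n + b ^ n)"
      using that by (simp add: algebra_simps)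
    also have "\<dots> \<le> (a + b) * (a + b) ^ n"
      using that Suc by (intro mult_left_mono) auto
    finally show ?case by simp
  qed simp
  show ?thesis
    using super[of "s - t" t] super[of "t - s" s] assms by (cases "t \<le> s") auto
qed

text \<open>The real part alone suffices. If \<open>Re c\<close> is negative, \<open>b\<close> is
  the nonnegative zero of \<open>Re c + t ^ n\<close>; otherwise 0 serves. The complex constant is
  thereby reduced to one real point.\<close>

lemma norm_add_power_ge:
  assumes "n \<noteq> 0"
  obtains b :: real where "\<And>t. 0 \<le> t \<Longrightarrow> \<bar>t - b\<bar> ^ n \<le> cmod (c + complex_of_real (t ^ n))"
proof -
  have Re: "\<bar>Re c + t ^ n\<bar> \<le> cmod (c + complex_of_real (t ^ n))" for t
    using abs_Re_le_cmod[of "c + complex_of_real (t ^ n)"] by simp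
  show thesis
  proof (cases "0 \<le> Re c")
    case True
    show ?thesis
    proof (rule that[of 0])
      fix t :: real assume "0 \<le> t"
      then show "\<bar>t - 0\<bar> ^ n \<le> cmod (c + complex_of_real (t ^ n))"
        using Re[of t] True by simp
    qed
  next
    case False
    define b where "b = root n (- Re c)"
    have b: "0 \<le> b" "b ^ n = - Re c"
      using False assms by (auto simp: b_def)
    show ?thesis
    proof (rule that[of b])
      fix t :: real assume "0 \<le> t"
      then show "\<bar>t - b\<bar> ^ n \<le> cmod (c + complex_of_real (t ^ n))"
        using Re[of t] abs_power_diff_ge[of t b n] b assms by simp
    qed
  qed
qed

text \<open>Dividing by the coefficient of \<open>t ^ (r+1)\<close> leaves a constant plus
  \<open>t ^ (r+1)\<close>. For \<open>z = 0\<close> that coefficient vanishes and the bound is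
  trivial.\<close>

lemma norm_taylor_factor_ge:
  obtains b :: real where
    "\<And>t. 0 \<le> t \<Longrightarrow> cmod z ^ (r+2) / fact (r+1) * \<bar>t - b\<bar> ^ (r+1) \<le> cmod (taylor_factor r z t)"
proof (cases "z = 0")
  case True
  show ?thesis
    by (rule that[of 0]) (simp add: True)
next
  case False
  define B where "B = z ^ (r+2) / fact (r+1)"
  have "B \<noteq> 0" using False by (simp add: B_def del: fact_Suc)
  define c where "c = (\<Sum>j=0..r+1. z ^ j / fact j) / B"
  have eq: "taylor_factor r z t = B * (c + complex_of_real (t ^ (r+1)))" for t
  proof -
    have "B * c = (\<Sum>j=0..r+1. z ^ j / fact j)"
      using \<open>B \<noteq> 0\<close> by (simp add: c_def)
    then show ?thesis
      unfolding taylor_factor_def distrib_left by (simp add: B_def del: power_Suc fact_Suc)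
  qed
  have norm_B: "cmod B = cmod z ^ (r+2) / fact (r+1)"
    by (simp add: B_def norm_divide norm_power norm_mult del: fact_Suc)
  obtain b :: real where b: "\<And>t. 0 \<le> t \<Longrightarrow> \<bar>t - b\<bar> ^ (r+1) \<le> cmod (c + complex_of_real (t ^ (r+1)))"
    using norm_add_power_ge[of "r+1" c] by (metis Suc_eq_plus1 nat.simps(3))
  show ?thesis
  proof (rule that[of b])
    fix t :: real assume "0 \<le> t"
    then show "cmod z ^ (r+2) / fact (r+1) * \<bar>t - b\<bar> ^ (r+1) \<le> cmod (taylor_factor r z t)"
      unfolding eq norm_mult norm_B[symmetric] by (intro mult_left_mono b) auto
  qed
qed

text \<open>The singularity at \<open>b\<close> is integrable: it contributes at most 2 on each side
  within distance 1, and the rest at most 1. What matters is that the bound does not depend on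
  \<open>b\<close>, which may lie anywhere on the line.\<close>

lemma nn_integral_inverse_sqrt_le:
  "(\<integral>\<^sup>+t. ennreal (1 / sqrt \<bar>t - b\<bar>) \<partial>unit_uniform) \<le> 5"
proof -
  let ?g = "\<lambda>x::real. ennreal (1 / sqrt \<bar>x\<bar>)"
  have half: "(\<integral>\<^sup>+x. ?g x * indicator {0..1} x \<partial>lborel) = 2"
  proof -
    have "((\<lambda>x. x powr - (1/2)) has_integral (1 powr (- (1/2) + 1) / (- (1/2) + 1))) {0..1::real}"
      by (rule has_integral_powr_from_0) auto
    then have "(\<integral>\<^sup>+x. ennreal (x powr - (1/2)) * indicator {0..1::real} x \<partial>lborel) = ennreal 2"
      by (subst nn_integral_has_integral_lebesgue'[where I=2]) auto
    \<comment> \<open>At 0 the integrands agree as well, since \<open>1 / 0\<close> and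
      \<open>0 powr a\<close> are both 0.\<close>
    moreover have "(\<integral>\<^sup>+x. ?g x * indicator {0..1} x \<partial>lborel) =
        (\<integral>\<^sup>+x. ennreal (x powr - (1/2)) * indicator {0..1::real} x \<partial>lborel)"
      by (intro nn_integral_cong)
        (auto simp: powr_minus_divide powr_half_sqrt split: split_indicator)
    ultimately show ?thesis by simp
  qed
  have "(\<integral>\<^sup>+x. ?g x * indicator {-1..0} x \<partial>lborel) = (\<integral>\<^sup>+x. ?g (-x) * indicator {-1..0} (-x) \<partial>lborel)"
    by (subst nn_integral_real_affine[where c="-1" and t=0]) auto
  also have "\<dots> = (\<integral>\<^sup>+x. ?g x * indicator {0..1} x \<partial>lborel)"
    by (intro nn_integral_cong) (auto split: split_indicator)
  finally have half': "(\<integral>\<^sup>+x. ?g x * indicator {-1..0} x \<partial>lborel) = 2"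
    using half by simp
  have "(\<integral>\<^sup>+t. ?g (t - b) \<partial>unit_uniform) = (\<integral>\<^sup>+t. ?g (t - b) * indicator {0..1} t \<partial>lborel)"
    by (subst nn_integral_uniform_measure) (auto simp: divide_ennreal_def)
  \<comment> \<open>Away from \<open>[b - 1, b + 1]\<close> the integrand is at most 1.\<close>
  also have "\<dots> \<le> (\<integral>\<^sup>+t. ?g (t - b) * indicator {-1..0} (t - b) +
      ?g (t - b) * indicator {0..1} (t - b) + indicator {0..1} t \<partial>lborel)"
    by (intro nn_integral_mono) (auto split: split_indicator simp: real_sqrt_ge_one)
  also have "\<dots> = (\<integral>\<^sup>+t. ?g (t - b) * indicator {-1..0} (t - b) \<partial>lborel) +
      (\<integral>\<^sup>+t. ?g (t - b) * indicator {0..1} (t - b) \<partial>lborel) + 1"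
    by (simp add: nn_integral_add)
  also have "(\<integral>\<^sup>+t. ?g (t - b) * indicator {-1..0} (t - b) \<partial>lborel) = 2"
    using half' by (subst nn_integral_real_affine[where c=1 and t=b]) auto
  also have "(\<integral>\<^sup>+t. ?g (t - b) * indicator {0..1} (t - b) \<partial>lborel) = 2"
    using half by (subst nn_integral_real_affine[where c=1 and t=b]) auto
  finally show ?thesis by simp
qed

lemma bounded_region_ref: "bounded (region_ref r)"
proof -
  have "\<forall>\<^sub>F z in at_infinity. norm (\<Sum>j\<le>r+2. (1 / fact j) * z ^ j :: complex) \<ge> 1"
    \<comment> \<open>The witness 1 is the index of a nonzero coefficient of positive degree, so the
      polynomial is not constant.\<close>
    by (rule polyfun_extremal) (auto intro!: exI[of _ 1])
  then obtain C where C: "\<And>z :: complex. C \<le> norm z \<Longrightarrow> 1 \<le> norm (\<Sum>j\<le>r+2. (1 / fact j) * z ^ j)"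
    by (auto simp: eventually_at_infinity)
  have "norm z \<le> C" if "z \<in> region_ref r" for z
  proof (rule ccontr)
    assume "\<not> norm z \<le> C"
    then have "1 \<le> norm (\<Sum>j\<le>r+2. (1 / fact j) * z ^ j)"
      using C[of z] by linarith
    also have "(\<Sum>j\<le>r+2. (1 / fact j) * z ^ j) = (\<Sum>j=0..r+2. z ^ j / fact j)"
      by (intro sum.cong) auto
    finally show False
      using that by (simp only: region_ref_def mem_Collect_eq)
  qed
  then show ?thesis
    by (auto simp: bounded_iff)
qed

section \<open>The stability regions of the scheme\<close>

locale iid_unit_uniform = iid_sequence M \<tau> unit_uniform
  for M :: "'a measure" and \<tau> :: "nat \<Rightarrow> 'a \<Rightarrow> real"
begin

lemma taylor_scheme_measurable [measurable]: "taylor_scheme r \<eta> \<tau> z k \<in> borel_measurable M"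
  unfolding taylor_scheme_def by measurable

text \<open>The squared modulus is multiplicative, so independence gives a power. Finiteness of the
  value also yields square-integrability.\<close>

lemma nn_integral_taylor_scheme:
  "(\<integral>\<^sup>+\<omega>. ennreal ((cmod (taylor_scheme r \<eta> \<tau> z k \<omega>))\<^sup>2) \<partial>M) =
     ennreal ((cmod \<eta>)\<^sup>2 * second_moment r z ^ k)"
proof -
  have "(\<integral>\<^sup>+\<omega>. ennreal ((cmod (taylor_scheme r \<eta> \<tau> z k \<omega>))\<^sup>2) \<partial>M) =
     (\<integral>\<^sup>+\<omega>. ennreal ((cmod \<eta>)\<^sup>2) * (\<Prod>l=1..k. ennreal ((cmod (taylor_factor r z (\<tau> l \<omega>)))\<^sup>2)) \<partial>M)"
    by (intro nn_integral_cong)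
      (simp add: taylor_scheme_def norm_mult prod_norm[symmetric] power_mult_distrib
        prod_power_distrib prod_ennreal ennreal_mult prod_nonneg)
  also have "\<dots> = ennreal ((cmod \<eta>)\<^sup>2) *
     (\<integral>\<^sup>+\<omega>. (\<Prod>l=1..k. ennreal ((cmod (taylor_factor r z (\<tau> l \<omega>)))\<^sup>2)) \<partial>M)"
    by (intro nn_integral_cmult) measurable
  also have "\<dots> = ennreal ((cmod \<eta>)\<^sup>2) * ennreal (second_moment r z) ^ k"
    by (subst nn_integral_prod) (auto simp: nn_integral_second_moment)
  finally show ?thesis
    by (simp add: ennreal_mult ennreal_power second_moment_nonneg)
qed

lemma region_MS_iff:
  assumes "\<eta> \<noteq> 0"
  shows "z \<in> region_MS M \<tau> \<eta> r \<longleftrightarrow> second_moment r z < 1"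
proof -
  have int: "integrable M (\<lambda>\<omega>. (cmod (taylor_scheme r \<eta> \<tau> z k \<omega>))\<^sup>2)" for k
    by (rule integrableI_nonneg) (auto simp: nn_integral_taylor_scheme)
  have eq: "(\<integral>\<omega>. (cmod (taylor_scheme r \<eta> \<tau> z k \<omega>))\<^sup>2 \<partial>M) = (cmod \<eta>)\<^sup>2 * second_moment r z ^ k" for k
    by (rule integral_eq_nn_integral[THEN trans])
      (auto simp: nn_integral_taylor_scheme second_moment_nonneg)
  have "(\<lambda>k. (cmod \<eta>)\<^sup>2 * second_moment r z ^ k) \<longlonglongrightarrow> 0 \<longleftrightarrow> (\<lambda>k. second_moment r z ^ k) \<longlonglongrightarrow> 0"
    using assms by (simp add: tendsto_mult_left_iff[where l=0, simplified])
  also have "\<dots> \<longleftrightarrow> second_moment r z < 1"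
  \<comment> \<open>If \<open>second_moment r z\<close> were at least 1, so would be all its
    powers.\<close>
  proof
    assume "(\<lambda>k. second_moment r z ^ k) \<longlonglongrightarrow> 0"
    then have "\<forall>\<^sub>F k in sequentially. second_moment r z ^ k < 1"
      by (rule order_tendstoD) simp
    then obtain k where "second_moment r z ^ k < 1"
      using eventually_happens'[OF sequentially_bot] by blast
    then show "second_moment r z < 1"
      using one_le_power[of "second_moment r z" k] by linarith
  qed (simp add: LIMSEQ_realpow_zero second_moment_nonneg)
  finally show ?thesis
    using int eq by (simp add: region_MS_def tendsto_zero_L2_def)
qed

lemma region_MS_subset_ref:
  assumes "\<eta> \<noteq> 0"
  shows "region_MS M \<tau> \<eta> r \<subseteq> region_ref r"
proof
  fix z assume "z \<in> region_MS M \<tau> \<eta> r"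
  then have "(cmod (\<Sum>j=0..r+2. z ^ j / fact j))\<^sup>2 < 1"
    using region_MS_iff[OF assms] norm_taylor_poly_le_second_moment[of z r] by fastforce
  then show "z \<in> region_ref r"
    unfolding region_ref_def by (simp only: abs_square_less_1 abs_norm_cancel mem_Collect_eq)
qed

lemma region_MS_subset_AS:
  assumes "\<eta> \<noteq> 0"
  shows "region_MS M \<tau> \<eta> r \<subseteq> region_AS M \<tau> \<eta> r"
proof
  fix z assume "z \<in> region_MS M \<tau> \<eta> r"
  then have "(\<integral>\<^sup>+t. ennreal ((cmod (taylor_factor r z t))\<^sup>2) \<partial>unit_uniform) < 1"
    by (simp add: region_MS_iff[OF assms] nn_integral_second_moment)
  then have "AE \<omega> in M. (\<lambda>k. \<Prod>l=1..k. (cmod (taylor_factor r z (\<tau> l \<omega>)))\<^sup>2) \<longlonglongrightarrow> 0"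
    by (intro AE_prod_tendsto_0) auto
  then have "AE \<omega> in M. (\<lambda>k. taylor_scheme r \<eta> \<tau> z k \<omega>) \<longlonglongrightarrow> 0"
  proof eventually_elim
    case (elim \<omega>)
    \<comment> \<open>The square root undoes the squaring that brought in the second moment.\<close>
    then have "(\<lambda>k. sqrt (\<Prod>l=1..k. (cmod (taylor_factor r z (\<tau> l \<omega>)))\<^sup>2)) \<longlonglongrightarrow> sqrt 0"
      by (rule tendsto_real_sqrt)
    then have "(\<lambda>k. cmod (\<Prod>l=1..k. taylor_factor r z (\<tau> l \<omega>))) \<longlonglongrightarrow> 0"
      by (simp add: prod_power_distrib[symmetric] prod_norm prod_nonneg)
    then have "(\<lambda>k. \<Prod>l=1..k. taylor_factor r z (\<tau> l \<omega>)) \<longlonglongrightarrow> 0"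
      by (simp add: tendsto_norm_zero_iff)
    then show ?case
      unfolding taylor_scheme_def by (rule tendsto_mult_right_zero)
  qed
  then show "z \<in> region_AS M \<tau> \<eta> r"
    by (simp add: region_AS_def)
qed

text \<open>Countably many null events are discarded at once. Avoiding \<open>b\<close> keeps the
  weights of the negative moment argument nonzero.\<close>

lemma AE_all_nonneg_neq:
  "AE \<omega> in M. \<forall>l\<ge>1. 0 \<le> \<tau> l \<omega> \<and> \<tau> l \<omega> \<noteq> b"
proof -
  have "AE t in lborel. t \<noteq> b"
    by (rule AE_lborel_singleton)
  then have "AE t in unit_uniform. t \<noteq> b"
    by (intro AE_uniform_measureI) auto
  with AE_unit_uniform have "AE t in unit_uniform. 0 \<le> t \<and> t \<noteq> b"
    by eventually_elim auto
  then have "AE \<omega> in M. 0 \<le> \<tau> l \<omega> \<and> \<tau> l \<omega> \<noteq> b" if "l \<ge> 1" for l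
    by (intro AE_distrD[OF rv[OF that]]) (simp only: law[OF that])
  then show ?thesis
    by (simp add: AE_all_countable AE_impI)
qed

text \<open>The constant is 36 = 6 * 6, where 6 exceeds the bound 5 for the mean of the inverse
  square root; the square compensates for that root.\<close>

lemma region_AS_norm_le:
  assumes "\<eta> \<noteq> 0" and "z \<in> region_AS M \<tau> \<eta> r"
  shows "cmod z ^ (r+2) / fact (r+1) \<le> 36 ^ (r+1)"
proof (rule ccontr)
  assume large: "\<not> ?thesis"
  \<comment> \<open>\<open>n\<close> and \<open>R\<close> are chosen so that \<open>w t ^ n\<close>
    is exactly the lower bound for the factor; \<open>R\<close> is the constant \<open>c\<close> of
    the overview.\<close>
  define n where "n = 2 * (r+1)"
  define R where "R = root n (cmod z ^ (r+2) / fact (r+1))"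
  have n: "n > 0" by (simp add: n_def)
  have R_pow: "R ^ n = cmod z ^ (r+2) / fact (r+1)"
    unfolding R_def using n by (intro real_root_pow_pos2) auto
  have "(6::real) ^ n = 36 ^ (r+1)"
    unfolding n_def power_mult by simp
  then have "6 ^ n < R ^ n"
    using large R_pow by linarith
  then have R: "R > 6"
    by (rule power_less_imp_less_base) (simp add: R_def n)
  obtain b :: real where b:
    "\<And>t. 0 \<le> t \<Longrightarrow> cmod z ^ (r+2) / fact (r+1) * \<bar>t - b\<bar> ^ (r+1) \<le> cmod (taylor_factor r z t)"
    using norm_taylor_factor_ge by blast
  define w where "w t = R * sqrt \<bar>t - b\<bar>" for t
  have [measurable]: "w \<in> borel_measurable borel"
    unfolding w_def by measurable
  have w_nonneg: "0 \<le> w t" for t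
    using R by (simp add: w_def)
  have w_le: "w t ^ n \<le> cmod (taylor_factor r z t)" if "0 \<le> t" for t
  proof -
    have "sqrt \<bar>t - b\<bar> ^ n = \<bar>t - b\<bar> ^ (r+1)"
      unfolding n_def power_mult by simp
    then show ?thesis
      using b[OF that] by (simp only: w_def power_mult_distrib R_pow)
  qed
  have "(\<integral>\<^sup>+t. ennreal (1 / w t) \<partial>unit_uniform) =
      (\<integral>\<^sup>+t. ennreal (1 / R) * ennreal (1 / sqrt \<bar>t - b\<bar>) \<partial>unit_uniform)"
    using R by (intro nn_integral_cong) (simp add: w_def ennreal_mult[symmetric])
  also have "\<dots> = ennreal (1 / R) * (\<integral>\<^sup>+t. ennreal (1 / sqrt \<bar>t - b\<bar>) \<partial>unit_uniform)"
    by (intro nn_integral_cmult) measurable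
  also have "\<dots> \<le> ennreal (1 / R) * ennreal 5"
    using nn_integral_inverse_sqrt_le[of b] by (intro mult_left_mono) auto
  also have "\<dots> = ennreal (5 / R)"
    using R by (subst ennreal_mult[symmetric]) auto
  also have "\<dots> < 1"
    using R by simp
  finally have "AE \<omega> in M. (\<lambda>k. \<Prod>l=1..k. 1 / w (\<tau> l \<omega>)) \<longlonglongrightarrow> 0"
    using w_nonneg by (intro AE_prod_tendsto_0) auto
  moreover have "AE \<omega> in M. (\<lambda>k. taylor_scheme r \<eta> \<tau> z k \<omega>) \<longlonglongrightarrow> 0"
    using assms by (simp add: region_AS_def)
  moreover note AE_all_nonneg_neq[of b]
  ultimately have "AE \<omega> in M. False"
  proof eventually_elim
    case (elim \<omega>)
    let ?P = "\<lambda>k. \<Prod>l=1..k. w (\<tau> l \<omega>)"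
    let ?F = "\<lambda>k. \<Prod>l=1..k. taylor_factor r z (\<tau> l \<omega>)"
    have "(\<lambda>k. (1 / \<eta>) * taylor_scheme r \<eta> \<tau> z k \<omega>) \<longlonglongrightarrow> 0"
      using elim(2) by (rule tendsto_mult_right_zero)
    then have "?F \<longlonglongrightarrow> 0"
      using assms(1) by (simp add: taylor_scheme_def)
    then have F: "(\<lambda>k. cmod (?F k)) \<longlonglongrightarrow> 0"
      by (rule tendsto_norm_zero)
    have "?P k ^ n \<le> cmod (?F k)" for k
      unfolding prod_norm[symmetric] prod_power_distrib
      using elim(3) w_nonneg w_le by (intro prod_mono) auto
    then have "(\<lambda>k. ?P k ^ n) \<longlonglongrightarrow> 0"
      by (intro tendsto_sandwich[OF _ _ tendsto_const F])
        (simp_all add: prod_nonneg w_nonneg)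
    moreover have "(\<lambda>k. (\<Prod>l=1..k. 1 / w (\<tau> l \<omega>)) ^ n) \<longlonglongrightarrow> 0 ^ n"
      using elim(1) by (rule tendsto_power)
    \<comment> \<open>Both sequences tend to 0, yet their product is constantly 1.\<close>
    ultimately have "(\<lambda>k. ?P k ^ n * (\<Prod>l=1..k. 1 / w (\<tau> l \<omega>)) ^ n) \<longlonglongrightarrow> 0 * 0 ^ n"
      by (rule tendsto_mult)
    moreover have "?P k ^ n * (\<Prod>l=1..k. 1 / w (\<tau> l \<omega>)) ^ n = 1" for k
    proof -
      have "?P k \<noteq> 0"
        using elim(3) R by (auto simp: w_def)
      then show ?thesis
        by (simp add: prod_dividef power_divide)
    qed
    ultimately show False
      using n LIMSEQ_unique[OF tendsto_const, of "1::real" 0] by simp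
  qed
  then show False
    by simp
qed

lemma bounded_region_AS:
  assumes "\<eta> \<noteq> 0"
  shows "bounded (region_AS M \<tau> \<eta> r)"
proof -
  have "cmod z \<le> max 1 (36 ^ (r+1) * fact (r+1))" if "z \<in> region_AS M \<tau> \<eta> r" for z
  proof (cases "cmod z \<le> 1")
    case False
    \<comment> \<open>Outside the unit disc \<open>cmod z\<close> is below its own power, so no root
      has to be taken.\<close>
    then have "cmod z \<le> cmod z ^ (r+2)"
      by (intro self_le_power) auto
    also have "\<dots> \<le> 36 ^ (r+1) * fact (r+1)"
      using region_AS_norm_le[OF assms that] by (simp add: field_simps del: power_Suc fact_Suc)
    finally show ?thesis by simp
  qed simp
  then show ?thesis
    unfolding bounded_iff by blast
qed

end

theorem theorem2:
  fixes M :: "'a measure" and \<tau> :: "nat \<Rightarrow> 'a \<Rightarrow> real" and \<eta> :: complex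
  assumes "prob_space M"
    and "prob_space.indep_vars M (\<lambda>_. borel) \<tau> {1..}"
    and "\<And>l. l \<ge> 1 \<Longrightarrow> distr M borel (\<tau> l) = uniform_measure lborel {0..1}"
    and "\<eta> \<noteq> 0"
  shows "(\<forall>r. \<exists>\<gamma>>0.
            region_MS M \<tau> \<eta> r \<subseteq> region_ref r \<inter> region_AS M \<tau> \<eta> r \<and>
            region_ref r \<inter> region_AS M \<tau> \<eta> r \<subseteq> region_ref r \<union> region_AS M \<tau> \<eta> r \<and>
            region_ref r \<union> region_AS M \<tau> \<eta> r \<subseteq> {z. cmod z < \<gamma>}) \<and>
         {z. Re z < 0} \<subseteq> (\<Union>r. region_MS M \<tau> \<eta> r)"
proof -
  interpret prob_space M by fact
  interpret iid_unit_uniform M \<tau>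
    by unfold_locales (use assms in auto)
  have "\<exists>\<gamma>>0. region_ref r \<union> region_AS M \<tau> \<eta> r \<subseteq> {z. cmod z < \<gamma>}" for r
  proof -
    have "bounded (region_ref r \<union> region_AS M \<tau> \<eta> r)"
      using bounded_region_ref bounded_region_AS[OF assms(4)] by simp
    then obtain \<gamma> where "\<gamma> > 0" "region_ref r \<union> region_AS M \<tau> \<eta> r \<subseteq> ball 0 \<gamma>"
      using bounded_subset_ballD by blast
    then show ?thesis
      by (auto simp: ball_def)
  qed
  moreover have "{z. Re z < 0} \<subseteq> (\<Union>r. region_MS M \<tau> \<eta> r)"
    using second_moment_less_1_if_Re_neg region_MS_iff[OF assms(4)] by blast
  ultimately show ?thesis
    using region_MS_subset_ref[OF assms(4)] region_MS_subset_AS[OF assms(4)]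
    by (meson Int_greatest inf_le1 le_supI1 order_trans)
qed

end
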